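(* Let $\alpha\in\mathbb{R}\setminus\{0\}$, let $w\in\mathbb{R}^3$, let $M$ be a $K^{\alpha}$-translator along $w$, and let $M^{\lambda}$ be the parallel surface to $M$ at distance $\lambda\in\mathbb{R}\setminus\{0\}$. Let $K,H$ (resp. $\bar K,\bar H$) denote the Gauss and mean curvatures of $M$ (resp. $M^{\lambda}$). Then $M^{\lambda}$ is a $\bar K^{\alpha}$-translator along the same $w$ if and only if one of the following relations holds (identically on the surface): (i) $\lambda K-2H=0$ or $\lambda\bar K+2\bar H=0$ (for arbitrary $\alpha\in\mathbb{R}\setminus\{0\}$); (ii) $\alpha$ is an odd integer, and $\lambda^2K-2\lambda H+2=0$ or $\lambda^2\bar K+2\lambda\bar H+2=0$. Thus, in these cases, $M$ and $M^{\lambda}$ move under the same $K^{\alpha}$-flow along the same direction $w$.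
   Context: A surface $M$ is a regular surface in $\mathbb{E}^3$ given by a parametrization $X(s,\theta)$ on a connected parameter domain, with unit normal $U=\frac{X_s\times X_\theta}{\|X_s\times X_\theta\|}$ and shape operator $S_p(v)=-\nabla_vU$. With principal curvatures $k_1,k_2$ (eigenvalues of $S_p$), the Gauss curvature is $K=k_1k_2$ and the mean curvature is $H=(k_1+k_2)/2$. For $\lambda\in\mathbb{R}\setminus\{0\}$, the parallel surface $M^{\lambda}$ is parametrized by $\bar X=X+\lambda U$ and is assumed regular, i.e. $1-2\lambda H+\lambda^2K=(1-\lambda k_1)(1-\lambda k_2)\neq0$. Its unit normal is $\bar U=\varepsilon U$ with $\varepsilon$ the sign of $1-2\lambda H+\lambda^2K$, and its curvatures are $\bar K=\frac{K}{1-2\lambda H+\lambda^2K}$ and $\bar H=\frac{H-\lambda K}{1-2\lambda H+\lambda^2K}$. For a constant $\alpha\neq0$, a surface with Gauss curvature $K$ and unit normal $U$ is a $K^{\alpha}$-translator along (with speed) the unit vector $w\in\mathbb{R}^3$ if $K^{\alpha}=\langle U,w\rangle$ everywhere on it; $M^{\lambda}$ is a $\bar K^{\alpha}$-translator along $w$ if $\bar K^{\alpha}=\langle\bar U,w\rangle$. Such a surface moves under the $K^{\alpha}$-flow $\partial_tX=-K^{\alpha}U$ along the direction $w$. The Gauss curvature of a translator is assumed nowhere zero, and the power $K^{\alpha}$ must be a well-defined real number: powers of negative numbers are used only for integer exponents. *)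

theory Defs
  imports "HOL-Analysis.Analysis"
begin

text \<open>
  A parametrized surface is a map from an open connected set of parameters \<open>(s, \<theta>)\<close> to
  \<open>real^3\<close>. On an open subset of a finite-dimensional space, \<open>f\<close> is of class \<open>C\<^sup>k\<^sup>+\<^sup>1\<close> iff it is
  differentiable and all its directional derivatives are of class \<open>C\<^sup>k\<close>.
\<close>

primrec Ck_on :: "nat \<Rightarrow> 'a::real_normed_vector set \<Rightarrow> ('a \<Rightarrow> 'b::real_normed_vector) \<Rightarrow> bool" where
  "Ck_on 0 \<Omega> f \<longleftrightarrow> continuous_on \<Omega> f"
| "Ck_on (Suc k) \<Omega> f \<longleftrightarrow>
     f differentiable_on \<Omega> \<and> (\<forall>v. Ck_on k \<Omega> (\<lambda>p. frechet_derivative f (at p) v))"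

definition smooth_on :: "'a::real_normed_vector set \<Rightarrow> ('a \<Rightarrow> 'b::real_normed_vector) \<Rightarrow> bool" where
  "smooth_on \<Omega> f \<longleftrightarrow> (\<forall>k. Ck_on k \<Omega> f)"

type_synonym surface = "real \<times> real \<Rightarrow> real^3"

definition partial_s :: "surface \<Rightarrow> surface" where
  "partial_s X p = frechet_derivative X (at p) (1, 0)"

definition partial_theta :: "surface \<Rightarrow> surface" where
  "partial_theta X p = frechet_derivative X (at p) (0, 1)"

definition regular_surface :: "(real \<times> real) set \<Rightarrow> surface \<Rightarrow> bool" where
  "regular_surface \<Omega> X \<longleftrightarrow> open \<Omega> \<and> connected \<Omega> \<and> smooth_on \<Omega> X \<and>
     (\<forall>p\<in>\<Omega>. cross3 (partial_s X p) (partial_theta X p) \<noteq> 0)"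

definition unit_normal :: "surface \<Rightarrow> surface" where
  "unit_normal X p =
     (let n = cross3 (partial_s X p) (partial_theta X p) in n /\<^sub>R norm n)"

definition tangent_plane :: "surface \<Rightarrow> real \<times> real \<Rightarrow> (real^3) set" where
  "tangent_plane X p = range (frechet_derivative X (at p))"

text \<open>
  The shape operator \<open>v \<mapsto> - \<nabla>\<^sub>v N\<close> with respect to a unit normal field \<open>N\<close> along \<open>X\<close>: for a
  tangent vector \<open>v = dX\<^sub>p a\<close> we have \<open>\<nabla>\<^sub>v N = dN\<^sub>p a\<close>. It is meaningful for \<open>v\<close> in the tangent
  plane, where \<open>a\<close> is unique by regularity. The normal field is an argument because on a
  parallel surface two unit normals occur: its own one, and the one of the original surface.
\<close>

definition shape_operator :: "surface \<Rightarrow> surface \<Rightarrow> real \<times> real \<Rightarrow> real^3 \<Rightarrow> real^3" where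
  "shape_operator X N p v =
     - frechet_derivative N (at p) (inv (frechet_derivative X (at p)) v)"

definition principal_curvatures :: "surface \<Rightarrow> surface \<Rightarrow> real \<times> real \<Rightarrow> real set" where
  "principal_curvatures X N p =
     {k. \<exists>v\<in>tangent_plane X p. v \<noteq> 0 \<and> shape_operator X N p v = k *\<^sub>R v}"

text \<open>
  The shape operator is self-adjoint on the two-dimensional tangent plane, so it has either two
  distinct eigenvalues or a single one of multiplicity two (umbilic points). Hence the maximum and
  the minimum of the set of eigenvalues are \<open>k\<^sub>1\<close> and \<open>k\<^sub>2\<close>, listed with multiplicity.
\<close>

definition gauss_curvature_wrt :: "surface \<Rightarrow> surface \<Rightarrow> real \<times> real \<Rightarrow> real" where
  "gauss_curvature_wrt X N p =
     Max (principal_curvatures X N p) * Min (principal_curvatures X N p)"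

definition mean_curvature_wrt :: "surface \<Rightarrow> surface \<Rightarrow> real \<times> real \<Rightarrow> real" where
  "mean_curvature_wrt X N p =
     (Max (principal_curvatures X N p) + Min (principal_curvatures X N p)) / 2"

definition gauss_curvature :: "surface \<Rightarrow> real \<times> real \<Rightarrow> real" where
  "gauss_curvature X = gauss_curvature_wrt X (unit_normal X)"

definition mean_curvature :: "surface \<Rightarrow> real \<times> real \<Rightarrow> real" where
  "mean_curvature X = mean_curvature_wrt X (unit_normal X)"

definition parallel_surface :: "real \<Rightarrow> surface \<Rightarrow> surface" where
  "parallel_surface lam X p = X p + lam *\<^sub>R unit_normal X p"

text \<open>
  With \<open>D = 1 - 2\<lambda>H + \<lambda>\<^sup>2K\<close>, the unit normal of the parallel surface at distance \<open>\<lambda>\<close> is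
  \<open>sgn D\<close> times that of \<open>X\<close>, and its Gauss curvature is \<open>K / D\<close> for either choice of the normal.
  The convention for its mean curvature is \<open>(H - \<lambda>K) / D\<close>, i.e. the one taken with respect to
  the unit normal of the original surface, for which the principal curvatures are
  \<open>k\<^sub>i / (1 - \<lambda>k\<^sub>i)\<close>; the other normal would give an additional factor \<open>sgn D\<close>.
\<close>

definition parallel_mean_curvature :: "real \<Rightarrow> surface \<Rightarrow> real \<times> real \<Rightarrow> real" where
  "parallel_mean_curvature lam X = mean_curvature_wrt (parallel_surface lam X) (unit_normal X)"

text \<open>
  Powers of nonzero reals: negative bases are admitted for integer exponents only.
\<close>

definition power_defined :: "real \<Rightarrow> real \<Rightarrow> bool" where
  "power_defined x \<alpha> \<longleftrightarrow> x > 0 \<or> (x < 0 \<and> \<alpha> \<in> \<int>)"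

definition real_power :: "real \<Rightarrow> real \<Rightarrow> real" where
  "real_power x \<alpha> = (if \<alpha> \<in> \<int> then x powi \<lfloor>\<alpha>\<rfloor> else x powr \<alpha>)"

definition gauss_translator :: "(real \<times> real) set \<Rightarrow> surface \<Rightarrow> real \<Rightarrow> real^3 \<Rightarrow> bool" where
  "gauss_translator \<Omega> X \<alpha> w \<longleftrightarrow> norm w = 1 \<and>
     (\<forall>p\<in>\<Omega>. gauss_curvature X p \<noteq> 0 \<and> power_defined (gauss_curvature X p) \<alpha> \<and>
        real_power (gauss_curvature X p) \<alpha> = unit_normal X p \<bullet> w)"

text \<open>
  \<open>Y t\<close> is a family of regular surfaces solving the flow \<open>\<partial>\<^sub>t Y = - K\<^sup>\<alpha> U\<close> in the usual geometric
  sense, i.e. up to tangential reparametrization: the normal component of the velocity is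
  \<open>- K\<^sup>\<alpha> U\<close>.
\<close>

definition gauss_power_flow :: "(real \<times> real) set \<Rightarrow> real \<Rightarrow> (real \<Rightarrow> surface) \<Rightarrow> bool" where
  "gauss_power_flow \<Omega> \<alpha> Y \<longleftrightarrow>
     (\<forall>t. regular_surface \<Omega> (Y t) \<and>
       (\<forall>p\<in>\<Omega>. (\<lambda>\<tau>. Y \<tau> p) differentiable (at t) \<and>
          power_defined (gauss_curvature (Y t) p) \<alpha> \<and>
          (vector_derivative (\<lambda>\<tau>. Y \<tau> p) (at t) \<bullet> unit_normal (Y t) p) *\<^sub>R unit_normal (Y t) p
            = - (real_power (gauss_curvature (Y t) p) \<alpha> *\<^sub>R unit_normal (Y t) p)))"

text \<open>
  The surface evolves by translation with unit speed in the direction of \<open>w\<close>. With the conventions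
  \<open>K\<^sup>\<alpha> = \<langle>U, w\<rangle>\<close> for translators and \<open>- K\<^sup>\<alpha> U\<close> for the flow, the velocity vector is \<open>- w\<close>.
\<close>

definition moves_along :: "(real \<times> real) set \<Rightarrow> surface \<Rightarrow> real \<Rightarrow> real^3 \<Rightarrow> bool" where
  "moves_along \<Omega> X \<alpha> w \<longleftrightarrow> norm w = 1 \<and> gauss_power_flow \<Omega> \<alpha> (\<lambda>t p. X p - t *\<^sub>R w)"

end

theory Submission
  imports Defs
begin

text \<open>
  Put \<open>f = 1 - 2\<lambda>H + \<lambda>\<^sup>2K\<close>. Passing from \<open>X\<close> to its parallel surface multiplies \<open>X\<^sub>s \<times> X\<^sub>\<theta>\<close> by \<open>f\<close>
  (lemma \<open>parallel_cross3\<close>). Hence the unit normal is multiplied by \<open>sgn f\<close>, the Gauss curvature becomes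
  \<open>K / f\<close> (lemma \<open>parallel_curvatures\<close>), and, given that \<open>X\<close> is a translator, the translator equation of
  the parallel surface reads \<open>(K / f)\<^sup>\<alpha> = sgn f \<cdot> K\<^sup>\<alpha>\<close>.
  
  Taking absolute values in this equation gives \<open>\<bar>f\<bar>\<^sup>\<alpha> = 1\<close>, so \<open>f = \<plusminus>1\<close> at every point. Since \<open>f\<close> is
  continuous and nowhere zero on a connected domain, its sign is constant
  (lemma \<open>parallel_factor_sign_constant\<close>), and only two cases remain. If \<open>f = 1\<close> everywhere, the equation
  holds for every \<open>\<alpha>\<close>; since \<open>\<lambda> \<noteq> 0\<close>, this is \<open>\<lambda>K - 2H = 0\<close>. If \<open>f = -1\<close> everywhere, the equation is
  \<open>(-K)\<^sup>\<alpha> = - K\<^sup>\<alpha>\<close>; one of \<open>K\<close> and \<open>-K\<close> is negative, so \<open>\<alpha>\<close> must be an integer, and the sign then forces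
  it to be odd; the condition on \<open>f\<close> is the first relation of (ii). The barred relations are the
  unbarred ones multiplied by \<open>-1 / f\<close> in (i) and by \<open>1 / f\<close> in (ii). The last claim holds because a translator that is moved with
  constant velocity \<open>-w\<close> has normal velocity \<open>-\<langle>U, w\<rangle> U = - K\<^sup>\<alpha> U\<close> at all times.
  
  The curvatures are the extreme eigenvalues of the shape operator, so their formulas require these
  eigenvalues to be real. This comes from the symmetry of the second fundamental form, which rests on
  the symmetry of second derivatives (lemma \<open>second_derivative_symmetric\<close>). From there on a surface
  enters only through the matrix of its shape operator in the basis \<open>X\<^sub>s, X\<^sub>\<theta>\<close>: the curvatures are its
  determinant and half of its trace (lemma \<open>curvatures_weingarten\<close>), and the parallel surface has the
  matrix \<open>A (1 - \<lambda>A)\<^sup>-\<^sup>1 = (A - \<lambda> det A) / f\<close> (lemma \<open>weingarten_parallel\<close>).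
\<close>

section \<open>Symmetry of second derivatives\<close>

text \<open>
  The second difference over a parallelogram is a difference of first differences, so the mean value
  theorem applies along \<open>u\<close> and then along \<open>v\<close>. Its left-hand side does not change when \<open>u\<close> and \<open>v\<close>
  are exchanged, which is what identifies the two mixed derivatives in the limit.
\<close>
lemma second_difference_mvt:
  fixes f :: "'a::real_normed_vector \<Rightarrow> real"
  assumes "h > 0"
    and inS: "\<And>x y. \<lbrakk>0 \<le> x; x \<le> h; 0 \<le> y; y \<le> h\<rbrakk> \<Longrightarrow> p + x *\<^sub>R u + y *\<^sub>R v \<in> S"
    and f': "\<And>q. q \<in> S \<Longrightarrow> (f has_derivative f' q) (at q)"
    and f'': "\<And>q. q \<in> S \<Longrightarrow> ((\<lambda>q. f' q u) has_derivative f'' q) (at q)"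
  shows "\<exists>x\<in>{0<..<h}. \<exists>y\<in>{0<..<h}.
           f (p + h *\<^sub>R u + h *\<^sub>R v) - f (p + h *\<^sub>R u) - f (p + h *\<^sub>R v) + f p
             = h\<^sup>2 * f'' (p + x *\<^sub>R u + y *\<^sub>R v) v"
proof -
  have lin1: "linear (f' q)" if "q \<in> S" for q
    using f'[OF that] has_derivative_linear by blast
  have lin2: "linear (f'' q)" if "q \<in> S" for q
    using f''[OF that] has_derivative_linear by blast
  define g where "g x = f (p + x *\<^sub>R u + h *\<^sub>R v) - f (p + x *\<^sub>R u)" for x
  have S0: "p + x *\<^sub>R u \<in> S" if "0 \<le> x" "x \<le> h" for x
    using inS[of x 0] that \<open>h > 0\<close> by simp
  have "\<exists>x\<in>{0<..<h}. g h - g 0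
      = (\<lambda>t. f' (p + x *\<^sub>R u + h *\<^sub>R v) (t *\<^sub>R u) - f' (p + x *\<^sub>R u) (t *\<^sub>R u)) (h - 0)"
  proof (rule mvt_simple[OF \<open>h > 0\<close>])
    fix x :: real assume x: "0 \<le> x" "x \<le> h"
    have 1: "p + x *\<^sub>R u + h *\<^sub>R v \<in> S" using inS[of x h] x \<open>h > 0\<close> by simp
    have "((\<lambda>x. f (p + x *\<^sub>R u + h *\<^sub>R v)) has_derivative (\<lambda>t. f' (p + x *\<^sub>R u + h *\<^sub>R v) (t *\<^sub>R u)))
        (at x within {0..h})"
      by (rule has_derivative_compose[of "\<lambda>x. p + x *\<^sub>R u + h *\<^sub>R v", OF _ f'[OF 1]])
         (auto intro!: derivative_eq_intros)
    moreover have "((\<lambda>x. f (p + x *\<^sub>R u)) has_derivative (\<lambda>t. f' (p + x *\<^sub>R u) (t *\<^sub>R u)))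
        (at x within {0..h})"
      by (rule has_derivative_compose[of "\<lambda>x. p + x *\<^sub>R u", OF _ f'[OF S0[OF x]]])
         (auto intro!: derivative_eq_intros)
    ultimately show "(g has_derivative
        (\<lambda>t. f' (p + x *\<^sub>R u + h *\<^sub>R v) (t *\<^sub>R u) - f' (p + x *\<^sub>R u) (t *\<^sub>R u))) (at x within {0..h})"
      unfolding g_def by (rule has_derivative_diff)
  qed
  then obtain x where x: "0 < x" "x < h"
    and gx: "g h - g 0 = f' (p + x *\<^sub>R u + h *\<^sub>R v) (h *\<^sub>R u) - f' (p + x *\<^sub>R u) (h *\<^sub>R u)" by auto
  have Sx: "p + x *\<^sub>R u + y *\<^sub>R v \<in> S" if "0 \<le> y" "y \<le> h" for y
    using inS[of x y] that x by simp
  have "\<exists>y\<in>{0<..<h}. f' (p + x *\<^sub>R u + h *\<^sub>R v) u - f' (p + x *\<^sub>R u + 0 *\<^sub>R v) u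
      = (\<lambda>t. f'' (p + x *\<^sub>R u + y *\<^sub>R v) (t *\<^sub>R v)) (h - 0)"
  proof (rule mvt_simple[OF \<open>h > 0\<close>])
    fix y :: real assume y: "0 \<le> y" "y \<le> h"
    show "((\<lambda>y. f' (p + x *\<^sub>R u + y *\<^sub>R v) u) has_derivative
        (\<lambda>t. f'' (p + x *\<^sub>R u + y *\<^sub>R v) (t *\<^sub>R v))) (at y within {0..h})"
      by (rule has_derivative_compose[of "\<lambda>y. p + x *\<^sub>R u + y *\<^sub>R v", OF _ f''[OF Sx[OF y]]])
         (auto intro!: derivative_eq_intros)
  qed
  then obtain y where y: "0 < y" "y < h"
    and fy: "f' (p + x *\<^sub>R u + h *\<^sub>R v) u - f' (p + x *\<^sub>R u) u = f'' (p + x *\<^sub>R u + y *\<^sub>R v) (h *\<^sub>R v)"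
    by auto
  have "g h - g 0 = h * (f' (p + x *\<^sub>R u + h *\<^sub>R v) u - f' (p + x *\<^sub>R u) u)"
    using gx lin1[OF Sx[of h]] lin1[OF S0[of x]] x \<open>h > 0\<close>
    by (simp add: linear_scale right_diff_distrib)
  also have "\<dots> = h\<^sup>2 * f'' (p + x *\<^sub>R u + y *\<^sub>R v) v"
    using fy lin2[OF Sx[of y]] y by (simp add: linear_scale power2_eq_square)
  finally show ?thesis using x y by (intro bexI[of _ x] bexI[of _ y]) (auto simp: g_def)
qed

text \<open>
  Both mixed derivatives are attained by the same second difference at points arbitrarily close to
  \<open>p\<close>. If they differed at \<open>p\<close>, continuity would keep them apart on a parallelogram small enough to lie
  in a ball around \<open>p\<close>.
\<close>
lemma second_derivative_symmetric_real:
  fixes f :: "'a::real_normed_vector \<Rightarrow> real"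
  assumes "open S" "p \<in> S"
    and f': "\<And>q. q \<in> S \<Longrightarrow> (f has_derivative f' q) (at q)"
    and fu: "\<And>q. q \<in> S \<Longrightarrow> ((\<lambda>q. f' q u) has_derivative fu q) (at q)"
    and fv: "\<And>q. q \<in> S \<Longrightarrow> ((\<lambda>q. f' q v) has_derivative fv q) (at q)"
    and cu: "continuous_on S (\<lambda>q. fu q v)" and cv: "continuous_on S (\<lambda>q. fv q u)"
  shows "fu p v = fv p u"
proof (rule ccontr)
  assume neq: "fu p v \<noteq> fv p u"
  define e where "e = dist (fu p v) (fv p u) / 2"
  have "e > 0" using neq by (simp add: e_def)
  have "isCont (\<lambda>q. fu q v) p" "isCont (\<lambda>q. fv q u) p"
    using cu cv assms(1,2) continuous_on_eq_continuous_at by blast+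
  then have "((\<lambda>q. fu q v) \<longlongrightarrow> fu p v) (nhds p)" "((\<lambda>q. fv q u) \<longlongrightarrow> fv p u) (nhds p)"
    using tendsto_at_iff_tendsto_nhds[of "\<lambda>q. fu q v"] tendsto_at_iff_tendsto_nhds[of "\<lambda>q. fv q u"]
    by (simp_all add: isCont_def)
  then have "\<forall>\<^sub>F q in nhds p. dist (fu q v) (fu p v) < e" "\<forall>\<^sub>F q in nhds p. dist (fv q u) (fv p u) < e"
    using tendstoD \<open>e > 0\<close> by blast+
  moreover have "\<forall>\<^sub>F q in nhds p. q \<in> S" using assms(1,2) eventually_nhds_in_open by blast
  ultimately have "\<forall>\<^sub>F q in nhds p. dist (fu q v) (fu p v) < e \<and> dist (fv q u) (fv p u) < e \<and> q \<in> S"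
    by eventually_elim auto
  then obtain d where "d > 0" and
    d: "\<And>q. dist q p < d \<Longrightarrow> dist (fu q v) (fu p v) < e \<and> dist (fv q u) (fv p u) < e \<and> q \<in> S"
    unfolding eventually_nhds_metric by blast
  \<comment> \<open>every point of the parallelogram with sides \<open>h u\<close> and \<open>h v\<close> is closer to \<open>p\<close> than \<open>d\<close>\<close>
  define h where "h = d / (norm u + norm v + 1)"
  have pos: "norm u + norm v + 1 > 0" by (simp add: add_nonneg_pos)
  have "h > 0" using \<open>d > 0\<close> pos by (simp add: h_def)
  have near: "dist (p + x *\<^sub>R u + y *\<^sub>R v) p < d" if "0 \<le> x" "x \<le> h" "0 \<le> y" "y \<le> h" for x y
  proof -
    have "dist (p + x *\<^sub>R u + y *\<^sub>R v) p \<le> x * norm u + y * norm v"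
      using norm_triangle_ineq[of "x *\<^sub>R u" "y *\<^sub>R v"] that by (simp add: dist_norm add.assoc)
    also have "\<dots> \<le> h * norm u + h * norm v" using that by (intro add_mono mult_right_mono) auto
    also have "\<dots> < h * (norm u + norm v + 1)" using \<open>h > 0\<close> by (simp add: algebra_simps)
    also have "\<dots> = d" using pos by (simp add: h_def)
    finally show ?thesis .
  qed
  obtain x y where xy: "0 < x" "x < h" "0 < y" "y < h" and
    1: "f (p + h *\<^sub>R u + h *\<^sub>R v) - f (p + h *\<^sub>R u) - f (p + h *\<^sub>R v) + f p
             = h\<^sup>2 * fu (p + x *\<^sub>R u + y *\<^sub>R v) v"
    using second_difference_mvt[of h p u v S f f' fu, OF \<open>h > 0\<close> _ f' fu] near d by force
  obtain x' y' where xy': "0 < x'" "x' < h" "0 < y'" "y' < h" and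
    2: "f (p + h *\<^sub>R v + h *\<^sub>R u) - f (p + h *\<^sub>R v) - f (p + h *\<^sub>R u) + f p
             = h\<^sup>2 * fv (p + x' *\<^sub>R v + y' *\<^sub>R u) u"
  proof -
    have "p + x *\<^sub>R v + y *\<^sub>R u \<in> S" if "0 \<le> x" "x \<le> h" "0 \<le> y" "y \<le> h" for x y
      using near[of y x] d that by (simp add: add_ac)
    then show ?thesis using that second_difference_mvt[of h p v u S f f' fv, OF \<open>h > 0\<close> _ f' fv] by force
  qed
  have "h\<^sup>2 * fu (p + x *\<^sub>R u + y *\<^sub>R v) v = h\<^sup>2 * fv (p + x' *\<^sub>R v + y' *\<^sub>R u) u"
    unfolding 1[symmetric] 2[symmetric] by (simp add: add_ac)
  then have "fu (p + x *\<^sub>R u + y *\<^sub>R v) v = fv (p + y' *\<^sub>R u + x' *\<^sub>R v) u"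
    using \<open>h > 0\<close> by (simp add: add_ac)
  moreover have "dist (fu (p + x *\<^sub>R u + y *\<^sub>R v) v) (fu p v) < e"
    using near[of x y] d xy by auto
  moreover have "dist (fv (p + y' *\<^sub>R u + x' *\<^sub>R v) u) (fv p u) < e"
    using near[of y' x'] d xy' by auto
  ultimately show False
    using dist_triangle_half_r[of "fu (p + x *\<^sub>R u + y *\<^sub>R v) v" "fu p v" "2 * e" "fv p u"]
    by (simp add: e_def)
qed

lemma second_derivative_symmetric:
  fixes f :: "'a::real_normed_vector \<Rightarrow> 'b::real_inner"
  assumes "open S" "p \<in> S" and C2: "Ck_on (Suc (Suc 0)) S f"
  shows "frechet_derivative (\<lambda>q. frechet_derivative f (at q) u) (at p) v
       = frechet_derivative (\<lambda>q. frechet_derivative f (at q) v) (at p) u"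
proof -
  let ?D = "\<lambda>f q. frechet_derivative f (at q)"
  have deriv: "(f has_derivative ?D f q) (at q)"
    "((\<lambda>q. ?D f q a) has_derivative ?D (\<lambda>q. ?D f q a) q) (at q)" if "q \<in> S" for q a
    using C2 that \<open>open S\<close>
    by (auto simp: differentiable_on_eq_differentiable_at frechet_derivative_works)
  have cont: "continuous_on S (\<lambda>q. ?D (\<lambda>q. ?D f q a) q b)" for a b
    using C2 by simp
  have "?D (\<lambda>q. ?D f q u) p v \<bullet> z = ?D (\<lambda>q. ?D f q v) p u \<bullet> z" for z
    by (rule second_derivative_symmetric_real[OF assms(1,2),
          of "\<lambda>q. f q \<bullet> z" "\<lambda>q a. ?D f q a \<bullet> z" u "\<lambda>q b. ?D (\<lambda>q. ?D f q u) q b \<bullet> z"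
             v "\<lambda>q b. ?D (\<lambda>q. ?D f q v) q b \<bullet> z"])
       (auto intro!: has_derivative_inner_left deriv continuous_intros cont)
  then show ?thesis by (metis vector_eq_rdot)
qed

section \<open>Linear algebra of the tangent plane\<close>
lemma frechet_derivative_coords:
  assumes "X differentiable (at p)"
  shows "frechet_derivative X (at p) v = fst v *\<^sub>R partial_s X p + snd v *\<^sub>R partial_theta X p"
proof -
  interpret linear "frechet_derivative X (at p)"
    using assms by (rule linear_frechet_derivative)
  have "v = fst v *\<^sub>R (1, 0) + snd v *\<^sub>R (0, 1)" by (simp add: prod_eq_iff)
  then show ?thesis by (metis add scale partial_s_def partial_theta_def)
qed

lemma cross3_combination:
  fixes x y :: "real^3"
  shows "cross3 (a *\<^sub>R x + b *\<^sub>R y) (c *\<^sub>R x + d *\<^sub>R y) = (a * d - b * c) *\<^sub>R cross3 x y"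
  by (simp add: cross3_simps forall_3)

lemma independent_of_cross3_nonzero:
  fixes x y :: "real^3"
  assumes "cross3 x y \<noteq> 0" and "a *\<^sub>R x + b *\<^sub>R y = 0"
  shows "a = 0 \<and> b = 0"
proof -
  have "a *\<^sub>R cross3 x y = cross3 (a *\<^sub>R x + b *\<^sub>R y) y"
    "b *\<^sub>R cross3 x y = cross3 x (a *\<^sub>R x + b *\<^sub>R y)"
    by (simp_all add: cross_add_left cross_add_right cross_mult_left cross_mult_right)
  then show ?thesis using assms by (metis cross_zero_left cross_zero_right scaleR_eq_0_iff)
qed

text \<open>
  Cramer's rule in the basis \<open>x, y, x \<times> y\<close>: it makes the derivatives of the unit normal combinations
  of the two partial derivatives of the surface.
\<close>
lemma orthogonal_to_cross3_in_span:
  fixes x y z :: "real^3"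
  assumes "cross3 x y \<noteq> 0" and "z \<bullet> cross3 x y = 0"
  obtains a b where "z = a *\<^sub>R x + b *\<^sub>R y"
proof -
  define n where "n = cross3 x y"
  have "(n \<bullet> n) *\<^sub>R z = (cross3 z y \<bullet> n) *\<^sub>R x + (cross3 x z \<bullet> n) *\<^sub>R y + (z \<bullet> n) *\<^sub>R n"
    unfolding n_def by (simp add: cross3_simps forall_3)
  then have "(n \<bullet> n) *\<^sub>R z = (cross3 z y \<bullet> n) *\<^sub>R x + (cross3 x z \<bullet> n) *\<^sub>R y"
    using assms by (simp add: n_def)
  moreover have "n \<bullet> n \<noteq> 0" using assms by (simp add: n_def)
  ultimately have "z = ((cross3 z y \<bullet> n) / (n \<bullet> n)) *\<^sub>R x + ((cross3 x z \<bullet> n) / (n \<bullet> n)) *\<^sub>R y"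
    by (metis (no_types, lifting) divide_inverse_commute scaleR_right_distrib scaleR_scaleR
        left_inverse scaleR_one)
  then show thesis using that by blast
qed

text \<open>
  A self-adjoint operator on a plane has real eigenvalues: \<open>(a - d)\<^sup>2 + 4bc\<close> is the discriminant of the
  characteristic polynomial of the matrix with columns \<open>(a, b)\<close> and \<open>(c, d)\<close>. With the Gram matrix
  \<open>E, F, G\<close> of the basis, self-adjointness reads \<open>(a - d) F = c E - b G\<close>; squaring
  it gives \<open>(a - d)\<^sup>2 F\<^sup>2 + 4bc E G = (c E + b G)\<^sup>2 \<ge> 0\<close>, where the Cauchy-Schwarz inequality
  allows \<open>F\<^sup>2\<close> to be replaced by \<open>E G\<close>.
\<close>
lemma weingarten_discriminant_nonneg:
  fixes x y :: "'a::real_inner"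
  assumes selfadj: "(a *\<^sub>R x + b *\<^sub>R y) \<bullet> y = x \<bullet> (c *\<^sub>R x + d *\<^sub>R y)"
    and "x \<noteq> 0" "y \<noteq> 0"
  shows "(a - d)\<^sup>2 + 4 * b * c \<ge> 0"
proof -
  define E F G where "E = x \<bullet> x" and "F = x \<bullet> y" and "G = y \<bullet> y"
  have pos: "E > 0" "G > 0" using assms by (auto simp: E_def G_def)
  have CS: "F\<^sup>2 \<le> E * G" by (simp add: E_def F_def G_def Cauchy_Schwarz_ineq)
  have "(a - d) * F = c * E - b * G"
    using selfadj by (simp add: E_def F_def G_def inner_add_left inner_add_right inner_commute algebra_simps)
  then have "(a - d)\<^sup>2 * F\<^sup>2 = (c * E - b * G)\<^sup>2" by (metis power_mult_distrib)
  also have "\<dots> = (c * E + b * G)\<^sup>2 - 4 * b * c * (E * G)"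
    by (simp add: power2_eq_square algebra_simps)
  finally have eq: "(a - d)\<^sup>2 * F\<^sup>2 + 4 * b * c * (E * G) = (c * E + b * G)\<^sup>2" by simp
  have "(a - d)\<^sup>2 * F\<^sup>2 \<le> (a - d)\<^sup>2 * (E * G)" using CS by (simp add: mult_left_mono)
  then have "0 \<le> ((a - d)\<^sup>2 + 4 * b * c) * (E * G)"
    using eq zero_le_power2[of "c * E + b * G"] unfolding distrib_right by linarith
  moreover have "E * G > 0" using pos by simp
  ultimately show ?thesis by (simp add: zero_le_mult_iff)
qed

section \<open>Curvatures from the matrix of the shape operator\<close>

text \<open>
  The matrix of the shape operator in the basis \<open>X\<^sub>s, X\<^sub>\<theta>\<close> has columns \<open>(a, b)\<close> and \<open>(c, d)\<close>. A
  nonnegative discriminant is part of the notion, because without real eigenvalues the maximum and the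
  minimum of the set of principal curvatures have no meaning. The normal field is a parameter since a
  parallel surface is considered both with its own unit normal and with that of the original surface.
\<close>
definition weingarten :: "surface \<Rightarrow> surface \<Rightarrow> real \<times> real \<Rightarrow> real \<Rightarrow> real \<Rightarrow> real \<Rightarrow> real \<Rightarrow> bool" where
  "weingarten X N p a b c d \<longleftrightarrow>
     X differentiable (at p) \<and> N differentiable (at p) \<and>
     cross3 (partial_s X p) (partial_theta X p) \<noteq> 0 \<and>
     - partial_s N p = a *\<^sub>R partial_s X p + b *\<^sub>R partial_theta X p \<and>
     - partial_theta N p = c *\<^sub>R partial_s X p + d *\<^sub>R partial_theta X p \<and>
     (a - d)\<^sup>2 + 4 * b * c \<ge> 0"

lemma singular_2x2:
  fixes \<alpha> \<beta> \<gamma> \<delta> :: real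
  shows "(\<exists>\<xi> \<eta>. (\<xi> \<noteq> 0 \<or> \<eta> \<noteq> 0) \<and> \<alpha> * \<xi> + \<gamma> * \<eta> = 0 \<and> \<beta> * \<xi> + \<delta> * \<eta> = 0)
           \<longleftrightarrow> \<alpha> * \<delta> - \<beta> * \<gamma> = 0" (is "?L \<longleftrightarrow> ?R")
proof
  assume ?L
  then obtain \<xi> \<eta> where nz: "\<xi> \<noteq> 0 \<or> \<eta> \<noteq> 0"
    and eqs: "\<alpha> * \<xi> + \<gamma> * \<eta> = 0" "\<beta> * \<xi> + \<delta> * \<eta> = 0" by blast
  have "(\<alpha> * \<delta> - \<beta> * \<gamma>) * \<xi> = \<delta> * (\<alpha> * \<xi> + \<gamma> * \<eta>) - \<gamma> * (\<beta> * \<xi> + \<delta> * \<eta>)"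
    "(\<alpha> * \<delta> - \<beta> * \<gamma>) * \<eta> = \<alpha> * (\<beta> * \<xi> + \<delta> * \<eta>) - \<beta> * (\<alpha> * \<xi> + \<gamma> * \<eta>)"
    by (simp_all add: algebra_simps)
  then show ?R using eqs nz by auto
next
  assume R: ?R
  consider "\<alpha> \<noteq> 0 \<or> \<gamma> \<noteq> 0" | "\<beta> \<noteq> 0 \<or> \<delta> \<noteq> 0" | "\<alpha> = 0" "\<beta> = 0" "\<gamma> = 0" "\<delta> = 0" by blast
  then show ?L
  proof cases
    case 1
    then show ?thesis using R by (intro exI[of _ "- \<gamma>"] exI[of _ \<alpha>]) (auto simp: algebra_simps)
  next
    case 2
    then show ?thesis using R by (intro exI[of _ "\<delta>"] exI[of _ "- \<beta>"]) (auto simp: algebra_simps)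
  qed auto
qed

text \<open>
  The derivative of \<open>X\<close> is injective, so eigenvectors can be sought among the parameter directions;
  there the eigenvalue equation is a homogeneous linear system in two unknowns.
\<close>
lemma principal_curvature_iff:
  assumes W: "weingarten X N p a b c d"
  shows "k \<in> principal_curvatures X N p \<longleftrightarrow> (a - k) * (d - k) - b * c = 0"
proof -
  define x y where "x = partial_s X p" and "y = partial_theta X p"
  define D where "D = frechet_derivative X (at p)"
  have dN: "N differentiable (at p)" using W by (simp add: weingarten_def)
  have nz: "cross3 x y \<noteq> 0" using W by (simp add: weingarten_def x_def y_def)
  have D: "D v = fst v *\<^sub>R x + snd v *\<^sub>R y" for v
    using W by (simp add: weingarten_def x_def y_def D_def frechet_derivative_coords)
  have D0: "D v = 0 \<longleftrightarrow> v = 0" for v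
    using independent_of_cross3_nonzero[OF nz, of "fst v" "snd v"] by (auto simp: D prod_eq_iff)
  have linD: "linear D" using W by (simp add: weingarten_def D_def linear_frechet_derivative)
  have "inj D" using D0 linear_injective_0[OF linD] by blast
  then have inv: "inv D (D v) = v" for v by simp
  have S: "shape_operator X N p (D v) = (a * fst v + c * snd v) *\<^sub>R x + (b * fst v + d * snd v) *\<^sub>R y" for v
  proof -
    have "shape_operator X N p (D v) = fst v *\<^sub>R (- partial_s N p) + snd v *\<^sub>R (- partial_theta N p)"
      by (simp add: shape_operator_def inv frechet_derivative_coords[OF dN] flip: D_def)
    also have "\<dots> = fst v *\<^sub>R (a *\<^sub>R x + b *\<^sub>R y) + snd v *\<^sub>R (c *\<^sub>R x + d *\<^sub>R y)"
      using W unfolding weingarten_def x_def y_def by metis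
    finally show ?thesis by (simp add: algebra_simps)
  qed
  have eig: "shape_operator X N p (D v) = k *\<^sub>R D v \<longleftrightarrow>
      (a - k) * fst v + c * snd v = 0 \<and> b * fst v + (d - k) * snd v = 0" for v
  proof -
    have diff: "shape_operator X N p (D v) - k *\<^sub>R D v =
        ((a - k) * fst v + c * snd v) *\<^sub>R x + (b * fst v + (d - k) * snd v) *\<^sub>R y"
      unfolding S by (simp add: D algebra_simps)
    have "shape_operator X N p (D v) = k *\<^sub>R D v \<longleftrightarrow> shape_operator X N p (D v) - k *\<^sub>R D v = 0" by simp
    also have "\<dots> \<longleftrightarrow> (a - k) * fst v + c * snd v = 0 \<and> b * fst v + (d - k) * snd v = 0"
      unfolding diff using independent_of_cross3_nonzero[OF nz] by force
    finally show ?thesis .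
  qed
  have "k \<in> principal_curvatures X N p \<longleftrightarrow> (\<exists>v. D v \<noteq> 0 \<and> shape_operator X N p (D v) = k *\<^sub>R D v)"
    by (auto simp: principal_curvatures_def tangent_plane_def D_def)
  also have "\<dots> \<longleftrightarrow> (\<exists>\<xi> \<eta>. (\<xi> \<noteq> 0 \<or> \<eta> \<noteq> 0) \<and> (a - k) * \<xi> + c * \<eta> = 0 \<and> b * \<xi> + (d - k) * \<eta> = 0)"
    unfolding eig D0 by (simp add: prod_eq_iff split_paired_Ex)
  finally show ?thesis unfolding singular_2x2 .
qed

text \<open>
  The characteristic polynomial splits as \<open>(k - k\<^sub>1) (k - k\<^sub>2)\<close>, so the set of principal curvatures is
  \<open>{k\<^sub>1, k\<^sub>2}\<close>, also when \<open>k\<^sub>1 = k\<^sub>2\<close>, and the two formulas are Vieta's.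
\<close>
lemma curvatures_weingarten:
  assumes W: "weingarten X N p a b c d"
  shows "gauss_curvature_wrt X N p = a * d - b * c" and "mean_curvature_wrt X N p = (a + d) / 2"
proof -
  define r where "r = sqrt ((a - d)\<^sup>2 + 4 * b * c)"
  define k1 k2 where "k1 = (a + d + r) / 2" and "k2 = (a + d - r) / 2"
  have rr: "r * r = (a - d)\<^sup>2 + 4 * b * c" and "r \<ge> 0"
    using W by (simp_all add: r_def weingarten_def)
  have sum: "k1 + k2 = a + d" by (simp add: k1_def k2_def field_simps)
  have prod: "k1 * k2 = a * d - b * c"
    using rr by (simp add: k1_def k2_def field_simps power2_eq_square)
  have "(a - k) * (d - k) - b * c = (k - k1) * (k - k2)" for k
  proof -
    have "(a - k) * (d - k) - b * c = k * k - (a + d) * k + (a * d - b * c)" by (simp add: algebra_simps)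
    also have "\<dots> = (k - k1) * (k - k2)" unfolding sum[symmetric] prod[symmetric] by (simp add: algebra_simps)
    finally show ?thesis .
  qed
  then have PC: "principal_curvatures X N p = {k1, k2}"
    using principal_curvature_iff[OF W] by auto
  have "k2 \<le> k1" using \<open>r \<ge> 0\<close> by (simp add: k1_def k2_def)
  then have "Max {k1, k2} = k1" "Min {k1, k2} = k2" by simp_all
  then show "gauss_curvature_wrt X N p = a * d - b * c" "mean_curvature_wrt X N p = (a + d) / 2"
    using sum prod by (simp_all add: gauss_curvature_wrt_def mean_curvature_wrt_def PC)
qed

section \<open>The shape operator of a regular surface\<close>
lemma differentiable_cross3:
  assumes "f differentiable (at p)" "g differentiable (at p)"
  shows "(\<lambda>q. cross3 (f q) (g q)) differentiable (at p)"
proof -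
  interpret bounded_bilinear cross3
    using bilinear_cross by (simp add: bilinear_conv_bounded_bilinear)
  show ?thesis using assms FDERIV unfolding differentiable_def by blast
qed

lemma regular_surface_differentiable:
  assumes "regular_surface \<Omega> X" "p \<in> \<Omega>"
  shows "X differentiable (at p)" "partial_s X differentiable (at p)" "partial_theta X differentiable (at p)"
proof -
  have "open \<Omega>" and "Ck_on (Suc (Suc 0)) \<Omega> X"
    using assms unfolding regular_surface_def smooth_on_def by blast+
  then show "X differentiable (at p)" "partial_s X differentiable (at p)" "partial_theta X differentiable (at p)"
    using assms(2) by (auto simp: differentiable_on_eq_differentiable_at partial_s_def[abs_def] partial_theta_def[abs_def])
qed

lemma unit_normal_sgn: "unit_normal X p = sgn (cross3 (partial_s X p) (partial_theta X p))"
  by (simp add: unit_normal_def sgn_div_norm Let_def)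

lemma unit_normal_orthogonal:
  "unit_normal X p \<bullet> partial_s X p = 0" "unit_normal X p \<bullet> partial_theta X p = 0"
  by (simp_all add: unit_normal_def Let_def dot_cross_self)

lemma unit_normal_self_inner:
  assumes "regular_surface \<Omega> X" "p \<in> \<Omega>"
  shows "unit_normal X p \<bullet> unit_normal X p = 1"
  using assms by (simp add: unit_normal_sgn regular_surface_def norm_sgn flip: power2_norm_eq_inner)

lemma unit_normal_differentiable:
  assumes "regular_surface \<Omega> X" "p \<in> \<Omega>"
  shows "unit_normal X differentiable (at p)"
proof -
  define n where "n q = cross3 (partial_s X q) (partial_theta X q)" for q
  have n: "n differentiable (at p)"
    unfolding n_def[abs_def] using assms by (intro differentiable_cross3 regular_surface_differentiable)
  have "n p \<noteq> 0" using assms by (simp add: n_def regular_surface_def)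
  then have "(\<lambda>q. norm (n q)) differentiable (at p)"
    using differentiable_chain_at[OF n differentiable_norm_at] by (simp add: o_def)
  then have "(\<lambda>q. inverse (norm (n q)) *\<^sub>R n q) differentiable (at p)"
    using n \<open>n p \<noteq> 0\<close> by (intro differentiable_scaleR differentiable_inverse) auto
  then show ?thesis by (simp add: unit_normal_def[abs_def] n_def Let_def)
qed

text \<open>
  Applied to \<open>\<langle>U, U\<rangle> = 1\<close> this shows that the derivatives of the unit normal are tangent; applied to
  \<open>\<langle>U, X\<^sub>s\<rangle> = \<langle>U, X\<^sub>\<theta>\<rangle> = 0\<close> it expresses the second fundamental form by second derivatives of \<open>X\<close>.
\<close>
lemma inner_constant_derivative:
  fixes f g :: "'a::real_normed_vector \<Rightarrow> 'b::real_inner"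
  assumes "open S" "p \<in> S" and const: "\<And>q. q \<in> S \<Longrightarrow> f q \<bullet> g q = k"
    and "f differentiable (at p)" "g differentiable (at p)"
  shows "frechet_derivative f (at p) v \<bullet> g p + f p \<bullet> frechet_derivative g (at p) v = 0"
proof -
  have "((\<lambda>q. f q \<bullet> g q) has_derivative
      (\<lambda>v. f p \<bullet> frechet_derivative g (at p) v + frechet_derivative f (at p) v \<bullet> g p)) (at p)"
    using assms(4,5) by (intro has_derivative_inner) (simp_all add: frechet_derivative_works)
  moreover have "((\<lambda>q. f q \<bullet> g q) has_derivative (\<lambda>v. 0)) (at p)"
    by (rule has_derivative_transform_within_open[OF has_derivative_const assms(1,2)]) (simp add: const)
  ultimately have "(\<lambda>v. f p \<bullet> frechet_derivative g (at p) v + frechet_derivative f (at p) v \<bullet> g p) = (\<lambda>v. 0)"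
    by (rule has_derivative_unique)
  then show ?thesis by (metis add.commute)
qed

text \<open>
  The discriminant condition is the point: \<open>\<langle>-U\<^sub>s, X\<^sub>\<theta>\<rangle> = \<langle>U, X\<^sub>\<theta>\<^sub>s\<rangle>\<close> and \<open>\<langle>-U\<^sub>\<theta>, X\<^sub>s\<rangle> = \<langle>U, X\<^sub>s\<^sub>\<theta>\<rangle>\<close>
  agree by the symmetry of second derivatives, so the shape operator is self-adjoint.
\<close>
lemma weingarten_exists:
  assumes X: "regular_surface \<Omega> X" and p: "p \<in> \<Omega>"
  obtains a b c d where "weingarten X (unit_normal X) p a b c d"
proof -
  let ?U = "unit_normal X"
  define x y u v where "x = partial_s X p" and "y = partial_theta X p"
    and "u = - partial_s ?U p" and "v = - partial_theta ?U p"
  have "open \<Omega>" and C2: "Ck_on (Suc (Suc 0)) \<Omega> X"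
    using X unfolding regular_surface_def smooth_on_def by blast+
  have nz: "cross3 x y \<noteq> 0" using X p by (simp add: regular_surface_def x_def y_def)
  have dU: "?U differentiable (at p)" using X p by (rule unit_normal_differentiable)
  note dX = regular_surface_differentiable[OF X p]
  have "frechet_derivative ?U (at p) e \<bullet> ?U p = 0" for e
    using inner_constant_derivative[OF \<open>open \<Omega>\<close> p unit_normal_self_inner[OF X] dU dU, of e]
    by (simp add: inner_commute)
  moreover have "norm (cross3 x y) *\<^sub>R ?U p = cross3 x y"
    using nz by (simp add: unit_normal_def Let_def x_def y_def)
  ultimately have "frechet_derivative ?U (at p) e \<bullet> cross3 x y = 0" for e
    by (metis inner_scaleR_right mult_zero_right)
  then have "u \<bullet> cross3 x y = 0" "v \<bullet> cross3 x y = 0"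
    by (simp_all add: u_def v_def partial_s_def[of ?U] partial_theta_def[of ?U])
  then obtain a b c d where u: "u = a *\<^sub>R x + b *\<^sub>R y" and v: "v = c *\<^sub>R x + d *\<^sub>R y"
    using orthogonal_to_cross3_in_span[OF nz] by metis
  have "u \<bullet> y = ?U p \<bullet> frechet_derivative (partial_theta X) (at p) (1, 0)"
    using inner_constant_derivative[OF \<open>open \<Omega>\<close> p unit_normal_orthogonal(2) dU dX(3), of "(1, 0)"]
    by (simp add: u_def y_def partial_s_def[of ?U])
  also have "\<dots> = ?U p \<bullet> frechet_derivative (partial_s X) (at p) (0, 1)"
    using second_derivative_symmetric[OF \<open>open \<Omega>\<close> p C2, of "(1, 0)" "(0, 1)"]
    by (simp add: partial_s_def[abs_def] partial_theta_def[abs_def])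
  also have "\<dots> = x \<bullet> v"
    using inner_constant_derivative[OF \<open>open \<Omega>\<close> p unit_normal_orthogonal(1) dU dX(2), of "(0, 1)"]
    by (simp add: v_def x_def partial_theta_def[of ?U] inner_commute)
  finally have "(a - d)\<^sup>2 + 4 * b * c \<ge> 0"
    using nz unfolding u v by (intro weingarten_discriminant_nonneg[of a x b y c d]) auto
  then have "weingarten X ?U p a b c d"
    using nz dU dX u v by (simp add: weingarten_def x_def y_def u_def v_def)
  then show thesis by (rule that)
qed

section \<open>The geometry of the parallel surface\<close>

text \<open>
  With principal curvatures \<open>k\<^sub>1, k\<^sub>2\<close> this is \<open>(1 - \<lambda>k\<^sub>1) (1 - \<lambda>k\<^sub>2)\<close>, the determinant of \<open>1 - \<lambda>S\<close> for the
  shape operator \<open>S\<close>, and so the oriented ratio of the area elements.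
\<close>
definition parallel_factor :: "real \<Rightarrow> surface \<Rightarrow> real \<times> real \<Rightarrow> real" where
  "parallel_factor lam X p = 1 - 2 * lam * mean_curvature X p + lam\<^sup>2 * gauss_curvature X p"

lemma parallel_factor_weingarten:
  assumes "weingarten X (unit_normal X) p a b c d"
  shows "parallel_factor lam X p = (1 - lam * a) * (1 - lam * d) - lam\<^sup>2 * (b * c)"
  by (simp add: parallel_factor_def mean_curvature_def gauss_curvature_def curvatures_weingarten[OF assms]
      algebra_simps power2_eq_square)

lemma parallel_partials:
  assumes W: "weingarten X (unit_normal X) p a b c d"
  defines "x \<equiv> partial_s X p" and "y \<equiv> partial_theta X p"
  shows "parallel_surface lam X differentiable (at p)"
    and "partial_s (parallel_surface lam X) p = (1 - lam * a) *\<^sub>R x + (- lam * b) *\<^sub>R y"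
    and "partial_theta (parallel_surface lam X) p = (- lam * c) *\<^sub>R x + (1 - lam * d) *\<^sub>R y"
proof -
  let ?U = "unit_normal X"
  have D: "(parallel_surface lam X has_derivative
      (\<lambda>v. frechet_derivative X (at p) v + lam *\<^sub>R frechet_derivative ?U (at p) v)) (at p)"
    unfolding parallel_surface_def[abs_def] using W
    by (intro has_derivative_add has_derivative_scaleR_right) (simp_all add: weingarten_def frechet_derivative_works)
  then show "parallel_surface lam X differentiable (at p)" by (rule differentiableI)
  have "- partial_s ?U p = a *\<^sub>R x + b *\<^sub>R y" "- partial_theta ?U p = c *\<^sub>R x + d *\<^sub>R y"
    using W by (simp_all add: weingarten_def x_def y_def)
  then have U: "partial_s ?U p = - (a *\<^sub>R x + b *\<^sub>R y)" "partial_theta ?U p = - (c *\<^sub>R x + d *\<^sub>R y)"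
    by (metis minus_minus)+
  have "partial_s (parallel_surface lam X) p = x + lam *\<^sub>R partial_s ?U p"
    "partial_theta (parallel_surface lam X) p = y + lam *\<^sub>R partial_theta ?U p"
    using frechet_derivative_at[OF D, symmetric] by (simp_all add: partial_s_def partial_theta_def x_def y_def)
  then show "partial_s (parallel_surface lam X) p = (1 - lam * a) *\<^sub>R x + (- lam * b) *\<^sub>R y"
    "partial_theta (parallel_surface lam X) p = (- lam * c) *\<^sub>R x + (1 - lam * d) *\<^sub>R y"
    unfolding U by (simp_all add: algebra_simps)
qed

text \<open>
  The derivative of the parallel surface is \<open>dX + \<lambda> dU = (1 - \<lambda>S) dX\<close>, and the cross product of the
  partial derivatives is multiplied by the determinant of \<open>1 - \<lambda>S\<close>.
\<close>
lemma parallel_cross3: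
  assumes "regular_surface \<Omega> X" "p \<in> \<Omega>"
  shows "cross3 (partial_s (parallel_surface lam X) p) (partial_theta (parallel_surface lam X) p)
       = parallel_factor lam X p *\<^sub>R cross3 (partial_s X p) (partial_theta X p)"
proof -
  obtain a b c d where W: "weingarten X (unit_normal X) p a b c d"
    using assms by (rule weingarten_exists)
  show ?thesis
    unfolding parallel_partials[OF W] cross3_combination parallel_factor_weingarten[OF W]
    by (simp add: power2_eq_square algebra_simps)
qed

lemma parallel_factor_nonzero:
  assumes "regular_surface \<Omega> X" "regular_surface \<Omega> (parallel_surface lam X)" "p \<in> \<Omega>"
  shows "parallel_factor lam X p \<noteq> 0"
  using assms parallel_cross3[OF assms(1,3), of lam] by (auto simp: regular_surface_def)

lemma parallel_unit_normal:
  assumes "regular_surface \<Omega> X" "p \<in> \<Omega>"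
  shows "unit_normal (parallel_surface lam X) p = sgn (parallel_factor lam X p) *\<^sub>R unit_normal X p"
  by (simp add: unit_normal_sgn parallel_cross3[OF assms] sgn_scaleR)

text \<open>
  Continuity of the factor is read off from the two normal vectors \<open>X\<^sub>s \<times> X\<^sub>\<theta>\<close>, whose ratio it is; the
  definition through eigenvalues would not show it directly. The domain is connected, so a
  nowhere vanishing factor keeps its sign.
\<close>
lemma parallel_factor_sign_constant:
  assumes X: "regular_surface \<Omega> X" and X': "regular_surface \<Omega> (parallel_surface lam X)"
  obtains "\<And>p. p \<in> \<Omega> \<Longrightarrow> parallel_factor lam X p > 0"
        | "\<And>p. p \<in> \<Omega> \<Longrightarrow> parallel_factor lam X p < 0"
proof -
  let ?f = "parallel_factor lam X"
  define n where "n Y q = cross3 (partial_s Y q) (partial_theta Y q)" for Y :: surface and q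
  have cont: "continuous_on \<Omega> (n Y)" if "regular_surface \<Omega> Y" for Y
    unfolding n_def[abs_def] using that
    by (intro continuous_at_imp_continuous_on ballI differentiable_imp_continuous_within
        differentiable_cross3 regular_surface_differentiable)
  have "n X q \<bullet> n X q \<noteq> 0" if "q \<in> \<Omega>" for q using X that by (simp add: regular_surface_def n_def)
  then have "continuous_on \<Omega> (\<lambda>q. (n (parallel_surface lam X) q \<bullet> n X q) / (n X q \<bullet> n X q))"
    using cont[OF X] cont[OF X'] by (intro continuous_intros) auto
  also have "?this \<longleftrightarrow> continuous_on \<Omega> ?f"
    using X by (intro continuous_on_cong) (auto simp: n_def parallel_cross3[OF X] regular_surface_def)
  finally have "connected (?f ` \<Omega>)"
    using X by (intro connected_continuous_image) (auto simp: regular_surface_def)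
  moreover have "0 \<notin> ?f ` \<Omega>" using parallel_factor_nonzero[OF X X'] by force
  ultimately have "(\<forall>q\<in>\<Omega>. ?f q > 0) \<or> (\<forall>q\<in>\<Omega>. ?f q < 0)"
    by (meson connectedD_interval image_eqI not_le order_less_imp_le linorder_less_linear)
  then show thesis using that by blast
qed

text \<open>
  The matrix is \<open>A (1 - \<lambda>A)\<^sup>-\<^sup>1\<close>, where \<open>A\<close> is the matrix for \<open>X\<close>. The adjugate of \<open>1 - \<lambda>A\<close> is
  \<open>1 - \<lambda> adj A\<close>, and \<open>A adj A = det A\<close>, so the product is \<open>(A - \<lambda> det A) / f\<close>. In this form the
  discriminant is visibly that of \<open>A\<close> divided by \<open>f\<^sup>2\<close>.
\<close>
lemma weingarten_parallel:
  assumes W: "weingarten X (unit_normal X) p a b c d" and f: "parallel_factor lam X p = f" "f \<noteq> 0"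
  shows "weingarten (parallel_surface lam X) (unit_normal X) p
           ((a - lam * (a * d - b * c)) / f) (b / f) (c / f) ((d - lam * (a * d - b * c)) / f)"
proof -
  define k where "k = a * d - b * c"
  define x y where "x = partial_s X p" and "y = partial_theta X p"
  let ?X' = "parallel_surface lam X"
  have fabcd: "f = (1 - lam * a) * (1 - lam * d) - lam\<^sup>2 * (b * c)"
    using f parallel_factor_weingarten[OF W] by simp
  have P: "partial_s ?X' p = (1 - lam * a) *\<^sub>R x + (- lam * b) *\<^sub>R y"
    "partial_theta ?X' p = (- lam * c) *\<^sub>R x + (1 - lam * d) *\<^sub>R y"
    using parallel_partials(2,3)[OF W] by (simp_all add: x_def y_def)
  \<comment> \<open>coordinates \<open>\<alpha> / f, \<beta> / f\<close> in the basis of the parallel surface turn into \<open>\<gamma>, \<delta>\<close> in the basis \<open>x, y\<close>\<close>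
  have comb: "(\<alpha> / f) *\<^sub>R partial_s ?X' p + (\<beta> / f) *\<^sub>R partial_theta ?X' p = \<gamma> *\<^sub>R x + \<delta> *\<^sub>R y"
    if "\<alpha> * (1 - lam * a) - \<beta> * (lam * c) = f * \<gamma>" "\<beta> * (1 - lam * d) - \<alpha> * (lam * b) = f * \<delta>" for \<alpha> \<beta> \<gamma> \<delta>
  proof -
    have "f *\<^sub>R ((\<alpha> / f) *\<^sub>R partial_s ?X' p + (\<beta> / f) *\<^sub>R partial_theta ?X' p)
        = \<alpha> *\<^sub>R partial_s ?X' p + \<beta> *\<^sub>R partial_theta ?X' p"
      using f(2) by (simp add: scaleR_right_distrib)
    also have "\<dots> = (\<alpha> * (1 - lam * a) - \<beta> * (lam * c)) *\<^sub>R x + (\<beta> * (1 - lam * d) - \<alpha> * (lam * b)) *\<^sub>R y"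
      unfolding P by (simp add: algebra_simps)
    also have "\<dots> = f *\<^sub>R (\<gamma> *\<^sub>R x + \<delta> *\<^sub>R y)" unfolding that by (simp add: algebra_simps)
    finally show ?thesis using f(2) by simp
  qed
  have "((a - lam * k) / f) *\<^sub>R partial_s ?X' p + (b / f) *\<^sub>R partial_theta ?X' p = a *\<^sub>R x + b *\<^sub>R y"
    "(c / f) *\<^sub>R partial_s ?X' p + ((d - lam * k) / f) *\<^sub>R partial_theta ?X' p = c *\<^sub>R x + d *\<^sub>R y"
    by (intro comb; simp add: fabcd k_def algebra_simps power2_eq_square)+
  moreover have "cross3 (partial_s ?X' p) (partial_theta ?X' p) = f *\<^sub>R cross3 x y"
    unfolding P cross3_combination fabcd by (simp add: algebra_simps power2_eq_square)
  moreover have "((a - lam * k) / f - (d - lam * k) / f)\<^sup>2 + 4 * (b / f) * (c / f) \<ge> 0"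
  proof -
    have "((a - lam * k) / f - (d - lam * k) / f)\<^sup>2 + 4 * (b / f) * (c / f) = ((a - d)\<^sup>2 + 4 * b * c) / f\<^sup>2"
      using f(2) by (simp add: field_simps power2_eq_square)
    then show ?thesis using W by (simp add: weingarten_def)
  qed
  ultimately show ?thesis
    using W f(2) parallel_partials(1)[OF W] by (simp add: weingarten_def x_def y_def k_def)
qed

text \<open>
  The relation between the normals is assumed on a neighbourhood of \<open>p\<close>, because it has to be
  differentiated. For the unit normal of the parallel surface it holds with \<open>r = sgn f\<close> thanks to
  the constant sign of \<open>f\<close>.
\<close>
lemma weingarten_scale_normal:
  assumes W: "weingarten X N p a b c d" and "open S" "p \<in> S" and N': "\<And>q. q \<in> S \<Longrightarrow> N' q = r *\<^sub>R N q"
  shows "weingarten X N' p (r * a) (r * b) (r * c) (r * d)"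
proof -
  have "(N has_derivative frechet_derivative N (at p)) (at p)"
    using W by (simp add: weingarten_def frechet_derivative_works)
  then have D: "(N' has_derivative (\<lambda>v. r *\<^sub>R frechet_derivative N (at p) v)) (at p)"
    by (rule has_derivative_transform_within_open[OF has_derivative_scaleR_right assms(2,3)]) (simp add: N')
  have "partial_s N' p = r *\<^sub>R partial_s N p" "partial_theta N' p = r *\<^sub>R partial_theta N p"
    using frechet_derivative_at[OF D, symmetric] by (simp_all add: partial_s_def partial_theta_def)
  then have "- partial_s N' p = r *\<^sub>R (- partial_s N p)" "- partial_theta N' p = r *\<^sub>R (- partial_theta N p)"
    by simp_all
  moreover have "(r * a - r * d)\<^sup>2 + 4 * (r * b) * (r * c) \<ge> 0"
  proof -
    have "(r * a - r * d)\<^sup>2 + 4 * (r * b) * (r * c) = r\<^sup>2 * ((a - d)\<^sup>2 + 4 * b * c)"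
      by (simp add: algebra_simps power2_eq_square)
    then show ?thesis using W by (simp add: weingarten_def)
  qed
  moreover have "N' differentiable (at p)" using D by (rule differentiableI)
  ultimately show ?thesis using W unfolding weingarten_def by (simp add: scaleR_right_distrib)
qed

text \<open>
  The Gauss curvature belongs to the parallel surface's own unit normal, which multiplies the matrix
  by \<open>sgn f\<close>; this sign occurs twice in the determinant and cancels. The mean curvature is taken with
  respect to the original normal, so no sign occurs.
\<close>
lemma parallel_curvatures:
  assumes X: "regular_surface \<Omega> X" and X': "regular_surface \<Omega> (parallel_surface lam X)" and p: "p \<in> \<Omega>"
  shows "gauss_curvature (parallel_surface lam X) p = gauss_curvature X p / parallel_factor lam X p"
    and "parallel_mean_curvature lam X p
           = (mean_curvature X p - lam * gauss_curvature X p) / parallel_factor lam X p"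
proof -
  obtain a b c d where W: "weingarten X (unit_normal X) p a b c d"
    using X p by (rule weingarten_exists)
  define f where "f = parallel_factor lam X p"
  define k where "k = a * d - b * c"
  have "f \<noteq> 0" using parallel_factor_nonzero[OF X X' p] by (simp add: f_def)
  have f: "f = 1 - lam * (a + d) + lam\<^sup>2 * k"
    using parallel_factor_weingarten[OF W, of lam] by (simp add: f_def k_def algebra_simps power2_eq_square)
  have KH: "gauss_curvature X p = k" "mean_curvature X p = (a + d) / 2"
    by (simp_all add: gauss_curvature_def mean_curvature_def curvatures_weingarten[OF W] k_def)
  note W' = weingarten_parallel[OF W f_def[symmetric] \<open>f \<noteq> 0\<close>, folded k_def]
  show "parallel_mean_curvature lam X p
           = (mean_curvature X p - lam * gauss_curvature X p) / parallel_factor lam X p"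
    unfolding parallel_mean_curvature_def curvatures_weingarten(2)[OF W'] KH f_def[symmetric]
    using \<open>f \<noteq> 0\<close> by (simp add: field_simps)
  have sgn: "sgn (parallel_factor lam X q) = sgn f" if "q \<in> \<Omega>" for q
  proof (rule parallel_factor_sign_constant[OF X X'])
  qed (use that p in \<open>auto simp: f_def\<close>)
  have W'': "weingarten (parallel_surface lam X) (unit_normal (parallel_surface lam X)) p
      (sgn f * ((a - lam * k) / f)) (sgn f * (b / f)) (sgn f * (c / f)) (sgn f * ((d - lam * k) / f))"
    using X by (intro weingarten_scale_normal[OF W' _ p])
      (auto simp: regular_surface_def parallel_unit_normal[OF X] sgn)
  have "gauss_curvature (parallel_surface lam X) p
      = (sgn f * sgn f) * (((a - lam * k) * (d - lam * k) - b * c) / (f * f))"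
    unfolding gauss_curvature_def curvatures_weingarten(1)[OF W''] using \<open>f \<noteq> 0\<close> by (simp add: field_simps)
  also have "sgn f * sgn f = 1" using \<open>f \<noteq> 0\<close> by (simp add: sgn_if)
  also have "(a - lam * k) * (d - lam * k) - b * c = k * f"
    unfolding f by (simp add: algebra_simps k_def power2_eq_square)
  finally show "gauss_curvature (parallel_surface lam X) p = gauss_curvature X p / parallel_factor lam X p"
    using \<open>f \<noteq> 0\<close> by (simp add: KH f_def)
qed

section \<open>Powers of real numbers\<close>
lemma abs_real_power:
  assumes "x \<noteq> 0" "power_defined x \<alpha>"
  shows "\<bar>real_power x \<alpha>\<bar> = \<bar>x\<bar> powr \<alpha>"
proof (cases "\<alpha> \<in> \<int>")
  case True
  then obtain m where m: "\<alpha> = of_int m" by (rule Ints_cases)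
  show ?thesis using assms(1) by (simp add: real_power_def m power_int_abs powr_real_of_int')
next
  case False
  then show ?thesis using assms by (simp add: real_power_def power_defined_def)
qed

lemma real_power_abs_eq_imp:
  assumes "x \<noteq> 0" "y \<noteq> 0" "power_defined x \<alpha>" "power_defined y \<alpha>" "\<alpha> \<noteq> 0"
    and eq: "\<bar>real_power x \<alpha>\<bar> = \<bar>real_power y \<alpha>\<bar>"
  shows "\<bar>x\<bar> = \<bar>y\<bar>"
proof -
  have "\<bar>x\<bar> powr \<alpha> = \<bar>y\<bar> powr \<alpha>" using eq abs_real_power[of x] abs_real_power[of y] assms(1-4) by simp
  then have "\<alpha> * ln \<bar>x\<bar> = \<alpha> * ln \<bar>y\<bar>"
    using ln_powr[of "\<bar>x\<bar>" \<alpha>] ln_powr[of "\<bar>y\<bar>" \<alpha>] assms(1,2) by auto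
  then show ?thesis using assms(1,2,5) by auto
qed

text \<open>
  One of \<open>x\<close> and \<open>-x\<close> is negative, so both powers are defined only for integer exponents, and a sign
  comes out of the power only for odd ones.
\<close>
lemma real_power_uminus_iff:
  assumes "x \<noteq> 0" "power_defined x \<alpha>"
  shows "power_defined (- x) \<alpha> \<and> real_power (- x) \<alpha> = - real_power x \<alpha>
     \<longleftrightarrow> (\<exists>m::int. odd m \<and> \<alpha> = of_int m)"
proof (cases "\<alpha> \<in> \<int>")
  case True
  then obtain m where m: "\<alpha> = of_int m" by (rule Ints_cases)
  have "power_defined (- x) \<alpha>" using assms(1) True by (auto simp: power_defined_def)
  moreover have "x powi m \<noteq> 0" using assms(1) by simp
  ultimately show ?thesis
    by (cases "even m") (auto simp: real_power_def m)
next
  case False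
  then show ?thesis using assms by (auto simp: power_defined_def)
qed

section \<open>Translators move by translation\<close>

text \<open>
  The derivative is the choice of a map with a certain property, and a constant shift does not affect
  this property. So the equation holds for all \<open>X\<close> and \<open>p\<close>, and everything defined through
  derivatives is translation invariant as a function on the whole parameter plane.
\<close>
lemma frechet_derivative_diff_const:
  "frechet_derivative (\<lambda>q. X q - c) (at p) = frechet_derivative X (at p)"
proof -
  have "((\<lambda>q. X q - c) has_derivative D) (at p) \<longleftrightarrow> (X has_derivative D) (at p)" for D
    using has_derivative_add_const[of X D "at p" "- c"] has_derivative_add_const[of "\<lambda>q. X q - c" D "at p" c]
    by (intro iffI) simp_all
  then show ?thesis by (simp add: frechet_derivative_def)
qed

lemma gauss_curvature_translate:
  "unit_normal (\<lambda>q. X q - c) = unit_normal X" "gauss_curvature (\<lambda>q. X q - c) = gauss_curvature X"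
proof -
  have P: "partial_s (\<lambda>q. X q - c) = partial_s X" "partial_theta (\<lambda>q. X q - c) = partial_theta X"
    by (simp_all add: fun_eq_iff partial_s_def partial_theta_def frechet_derivative_diff_const)
  then show U: "unit_normal (\<lambda>q. X q - c) = unit_normal X"
    by (simp add: fun_eq_iff unit_normal_def)
  show "gauss_curvature (\<lambda>q. X q - c) = gauss_curvature X"
    unfolding gauss_curvature_def U
    by (simp add: fun_eq_iff gauss_curvature_wrt_def principal_curvatures_def tangent_plane_def
        shape_operator_def frechet_derivative_diff_const)
qed

lemma regular_surface_translate:
  assumes "regular_surface \<Omega> X"
  shows "regular_surface \<Omega> (\<lambda>q. X q - c)"
proof -
  have "Ck_on k \<Omega> (\<lambda>q. X q - c)" if "Ck_on k \<Omega> X" for k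
    using that by (cases k)
      (auto simp: frechet_derivative_diff_const intro!: continuous_intros differentiable_on_diff)
  then show ?thesis
    using assms by (simp add: regular_surface_def smooth_on_def partial_s_def partial_theta_def
        frechet_derivative_diff_const)
qed

text \<open>
  By translation invariance the surface has the same unit normal and Gauss curvature at all times,
  and its velocity is \<open>-w\<close>, so the flow equation is the translator equation at every time.
\<close>
lemma translator_moves_along:
  assumes X: "regular_surface \<Omega> X" and T: "gauss_translator \<Omega> X \<alpha> w"
  shows "moves_along \<Omega> X \<alpha> w"
proof -
  have "((\<lambda>t. X p - t *\<^sub>R w) has_vector_derivative - w) (at t)" for p t
    by (auto intro!: derivative_eq_intros)
  then have vd: "(\<lambda>t. X p - t *\<^sub>R w) differentiable (at t)"
    "vector_derivative (\<lambda>t. X p - t *\<^sub>R w) (at t) = - w" for p t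
    by (auto intro: differentiableI_vector vector_derivative_at)
  have "gauss_power_flow \<Omega> \<alpha> (\<lambda>t p. X p - t *\<^sub>R w)"
    using T unfolding gauss_power_flow_def gauss_curvature_translate vd(2)
    by (auto simp: gauss_translator_def vd(1) inner_commute intro: regular_surface_translate[OF X])
  then show ?thesis using T by (simp add: moves_along_def gauss_translator_def)
qed

section \<open>Parallel surfaces of translators\<close>

text \<open>
  Everything reduces to the equation \<open>(K / f)\<^sup>\<alpha> = sgn f \<cdot> K\<^sup>\<alpha>\<close>. Its absolute value forces \<open>\<bar>f\<bar> = 1\<close>, and
  the constant sign of \<open>f\<close> separates the two alternatives globally.
\<close>
lemma parallel_translator_iff:
  assumes X: "regular_surface \<Omega> X" and X': "regular_surface \<Omega> (parallel_surface lam X)"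
    and T: "gauss_translator \<Omega> X \<alpha> w" and "\<alpha> \<noteq> 0"
  shows "gauss_translator \<Omega> (parallel_surface lam X) \<alpha> w \<longleftrightarrow>
           (\<forall>p\<in>\<Omega>. parallel_factor lam X p = 1) \<or>
           (\<exists>m::int. odd m \<and> \<alpha> = of_int m) \<and> (\<forall>p\<in>\<Omega>. parallel_factor lam X p = - 1)"
    (is "?T' \<longleftrightarrow> ?one \<or> ?odd \<and> ?minus")
proof -
  let ?K = "gauss_curvature X" and ?f = "parallel_factor lam X"
  have K: "?K p \<noteq> 0" "power_defined (?K p) \<alpha>" "real_power (?K p) \<alpha> = unit_normal X p \<bullet> w"
    if "p \<in> \<Omega>" for p
    using T that by (auto simp: gauss_translator_def)
  have f0: "?f p \<noteq> 0" if "p \<in> \<Omega>" for p using parallel_factor_nonzero[OF X X' that] .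
  have "norm w = 1" using T by (simp add: gauss_translator_def)
  then have T'_iff: "?T' \<longleftrightarrow> (\<forall>p\<in>\<Omega>. power_defined (?K p / ?f p) \<alpha> \<and>
      real_power (?K p / ?f p) \<alpha> = sgn (?f p) * real_power (?K p) \<alpha>)"
    by (simp add: gauss_translator_def parallel_curvatures(1)[OF X X'] parallel_unit_normal[OF X]
        K f0 cong: ball_cong)
  show ?thesis
  proof
    assume ?T'
    then have P: "power_defined (?K p / ?f p) \<alpha>" "real_power (?K p / ?f p) \<alpha> = sgn (?f p) * real_power (?K p) \<alpha>"
      if "p \<in> \<Omega>" for p using T'_iff that by auto
    have abs1: "\<bar>?f p\<bar> = 1" if "p \<in> \<Omega>" for p
    proof -
      have "\<bar>real_power (?K p / ?f p) \<alpha>\<bar> = \<bar>real_power (?K p) \<alpha>\<bar>"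
        using f0[OF that] P(2)[OF that] by (simp add: abs_mult abs_sgn_eq)
      then have "\<bar>?K p / ?f p\<bar> = \<bar>?K p\<bar>"
        using real_power_abs_eq_imp[of "?K p / ?f p" "?K p" \<alpha>]
          K(1,2)[OF that] f0[OF that] P(1)[OF that] \<open>\<alpha> \<noteq> 0\<close> by simp
      then show ?thesis using f0[OF that] K(1)[OF that] by (simp add: field_simps)
    qed
    from X X' show "?one \<or> ?odd \<and> ?minus"
    proof (rule parallel_factor_sign_constant)
      assume pos: "\<And>p. p \<in> \<Omega> \<Longrightarrow> ?f p > 0"
      have ?one
      proof
        fix p assume "p \<in> \<Omega>"
        then show "?f p = 1" using abs1[of p] pos[of p] by linarith
      qed
      then show ?thesis ..
    next
      assume neg: "\<And>p. p \<in> \<Omega> \<Longrightarrow> ?f p < 0"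
      have minus: ?minus
      proof
        fix p assume "p \<in> \<Omega>"
        then show "?f p = - 1" using abs1[of p] neg[of p] by linarith
      qed
      show ?thesis
      \<comment> \<open>parity of \<open>\<alpha>\<close> is read off at a point; on an empty domain the first alternative is vacuously true\<close>
      proof (cases "\<Omega> = {}")
        case False
        then obtain p where p: "p \<in> \<Omega>" by blast
        have "?f p = - 1" using minus p by blast
        then have "power_defined (- ?K p) \<alpha> \<and> real_power (- ?K p) \<alpha> = - real_power (?K p) \<alpha>"
          using P[OF p] by simp
        then have ?odd by (rule real_power_uminus_iff[OF K(1,2)[OF p], THEN iffD1])
        then show ?thesis using minus by blast
      qed simp
    qed
  next
    assume "?one \<or> ?odd \<and> ?minus"
    then show ?T'
    proof
      assume one: ?one
      show ?T'
        unfolding T'_iff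
      proof
        fix p assume p: "p \<in> \<Omega>"
        then have "?f p = 1" using one by blast
        then show "power_defined (?K p / ?f p) \<alpha> \<and>
            real_power (?K p / ?f p) \<alpha> = sgn (?f p) * real_power (?K p) \<alpha>"
          using K(2)[OF p] by simp
      qed
    next
      assume odd: "?odd \<and> ?minus"
      show ?T'
        unfolding T'_iff
      proof
        fix p assume p: "p \<in> \<Omega>"
        then have "?f p = - 1" using odd by blast
        moreover have "power_defined (- ?K p) \<alpha> \<and> real_power (- ?K p) \<alpha> = - real_power (?K p) \<alpha>"
          using real_power_uminus_iff[OF K(1,2)[OF p]] odd by blast
        ultimately show "power_defined (?K p / ?f p) \<alpha> \<and>
            real_power (?K p / ?f p) \<alpha> = sgn (?f p) * real_power (?K p) \<alpha>"
          by simp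
      qed
    qed
  qed
qed

text \<open>
  By the previous lemma it remains to identify each relation with \<open>f = 1\<close> or \<open>f = -1\<close>, pointwise. For
  the barred ones, \<open>\<lambda>K' + 2H' = -(\<lambda>K - 2H) / f\<close> and
  \<open>f (\<lambda>\<^sup>2K' + 2\<lambda>H' + 2) = \<lambda>\<^sup>2K - 2\<lambda>H + 2\<close>.
\<close>
theorem theorem1:
  fixes \<Omega> :: "(real \<times> real) set" and X :: surface
    and \<alpha> lam :: real and w :: "real^3"
    and K H K' H' :: "real \<times> real \<Rightarrow> real" and rel_i rel_ii :: bool
  defines "K \<equiv> gauss_curvature X"
    and "H \<equiv> mean_curvature X"
    and "K' \<equiv> gauss_curvature (parallel_surface lam X)"
    and "H' \<equiv> parallel_mean_curvature lam X"
    and "rel_i \<equiv> (\<forall>p\<in>\<Omega>. lam * K p - 2 * H p = 0) \<or> (\<forall>p\<in>\<Omega>. lam * K' p + 2 * H' p = 0)"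
    and "rel_ii \<equiv> (\<exists>m::int. odd m \<and> \<alpha> = of_int m) \<and>
           ((\<forall>p\<in>\<Omega>. lam^2 * K p - 2 * lam * H p + 2 = 0) \<or>
            (\<forall>p\<in>\<Omega>. lam^2 * K' p + 2 * lam * H' p + 2 = 0))"
  assumes "\<alpha> \<noteq> 0" and "lam \<noteq> 0"
    and "regular_surface \<Omega> X"
    and "gauss_translator \<Omega> X \<alpha> w"
    and "regular_surface \<Omega> (parallel_surface lam X)"
  shows "(gauss_translator \<Omega> (parallel_surface lam X) \<alpha> w \<longleftrightarrow> rel_i \<or> rel_ii) \<and>
         (rel_i \<or> rel_ii \<longrightarrow>
            moves_along \<Omega> X \<alpha> w \<and> moves_along \<Omega> (parallel_surface lam X) \<alpha> w)"
proof -
  let ?f = "parallel_factor lam X"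
  note X = \<open>regular_surface \<Omega> X\<close> and X' = \<open>regular_surface \<Omega> (parallel_surface lam X)\<close>
    and T = \<open>gauss_translator \<Omega> X \<alpha> w\<close>
  have f: "?f p = 1 - 2 * lam * H p + lam\<^sup>2 * K p" for p
    by (simp add: parallel_factor_def K_def H_def)
  have K': "K' p = K p / ?f p" and H': "H' p = (H p - lam * K p) / ?f p" and nz: "?f p \<noteq> 0"
    if "p \<in> \<Omega>" for p
    using parallel_curvatures[OF X X' that] parallel_factor_nonzero[OF X X' that]
    by (simp_all add: K_def H_def K'_def H'_def)
  have one: "lam * K p - 2 * H p = 0 \<longleftrightarrow> ?f p = 1" for p
  proof -
    have "?f p - 1 = lam * (lam * K p - 2 * H p)" unfolding f by (simp add: algebra_simps power2_eq_square)
    then show ?thesis using \<open>lam \<noteq> 0\<close> by auto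
  qed
  have minus: "lam\<^sup>2 * K p - 2 * lam * H p + 2 = 0 \<longleftrightarrow> ?f p = - 1" for p
    unfolding f by auto
  have one': "lam * K' p + 2 * H' p = 0 \<longleftrightarrow> ?f p = 1" if "p \<in> \<Omega>" for p
  proof -
    have "lam * K' p + 2 * H' p = - (lam * K p - 2 * H p) / ?f p"
      using nz[OF that] unfolding K'[OF that] H'[OF that] by (simp add: field_simps)
    then show ?thesis using nz[OF that] by (auto simp: one[symmetric])
  qed
  have minus': "lam\<^sup>2 * K' p + 2 * lam * H' p + 2 = 0 \<longleftrightarrow> ?f p = - 1" if "p \<in> \<Omega>" for p
  proof -
    have "?f p * (lam\<^sup>2 * K' p + 2 * lam * H' p + 2) = lam\<^sup>2 * K p + 2 * lam * (H p - lam * K p) + 2 * ?f p"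
      using nz[OF that] unfolding K'[OF that] H'[OF that] by (simp add: distrib_left)
    also have "\<dots> = lam\<^sup>2 * K p - 2 * lam * H p + 2"
      unfolding f by (simp add: algebra_simps power2_eq_square)
    finally show ?thesis using nz[OF that] unfolding minus[symmetric] by (metis mult_eq_0_iff)
  qed
  have iff: "gauss_translator \<Omega> (parallel_surface lam X) \<alpha> w \<longleftrightarrow> rel_i \<or> rel_ii"
    unfolding parallel_translator_iff[OF X X' T \<open>\<alpha> \<noteq> 0\<close>] rel_i_def rel_ii_def
    by (simp only: one minus one' minus' cong: ball_cong) blast
  then show ?thesis
    using translator_moves_along X X' T by blast
qed

end
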